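(* Let $n,d>0$ be integers, and let $P$ be a $d\times n$ real matrix. The following two statements are equivalent. 1. $G(P)=\{Pv\mid v\in\mathbb{Z}^n\}$ is dense in $\mathbb{R}^d$. 2. $\{PA\mid A \text{ is a good } n\times n \text{ matrix}\}$ is dense in the space of all $d\times n$ real matrices.
   Context: A step matrix is a square matrix obtained from the identity matrix by replacing one of its off-diagonal entries by $2$ or $-2$. An $n\times n$ matrix is called good if it belongs to the multiplicative group generated by the $n\times n$ step matrices (for $n=1$ there are no step matrices and only the identity is good). *)

theory Defs
  imports "HOL-Analysis.Analysis" "HOL-Algebra.Generated_Groups"
begin

definition GL :: "(real ^ 'n ^ 'n) monoid" where
  "GL = \<lparr>carrier = {A. invertible A}, mult = (**), one = mat 1\<rparr>"

lemma group_GL: "group (GL :: (real ^ 'n ^ 'n) monoid)"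
proof (rule groupI)
  fix A :: "real ^ 'n ^ 'n"
  assume "A \<in> carrier GL"
  then obtain B where "A ** B = mat 1" "B ** A = mat 1"
    by (auto simp: GL_def invertible_def)
  then show "\<exists>B\<in>carrier GL. B \<otimes>\<^bsub>GL\<^esub> A = \<one>\<^bsub>GL\<^esub>"
    by (auto simp: GL_def invertible_def)
qed (auto simp: GL_def invertible_mult matrix_mul_assoc invertible_def[of "mat 1"])

definition step_matrices :: "(real ^ 'n ^ 'n) set" where
  "step_matrices =
     {(\<chi> k l. if k = i \<and> l = j then c else mat 1 $ k $ l) | i j c. i \<noteq> j \<and> (c = 2 \<or> c = -2)}"

text \<open>If the index type has only one element, there are no step matrices and the generated
  subgroup is trivial. Good matrices have integer entries, but are represented as real matrices
  so that they can be multiplied with \<open>P\<close>.\<close>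

definition good :: "real ^ 'n ^ 'n \<Rightarrow> bool" where
  "good A \<longleftrightarrow> A \<in> generate GL step_matrices"

text \<open>Here \<open>v\<close> ranges over the integer lattice inside the real vector space.\<close>

definition G :: "real ^ 'n ^ 'd \<Rightarrow> (real ^ 'd) set" where
  "G P = {P *v v | v. \<forall>i. v $ i \<in> \<int>}"

end

theory Submission
  imports Defs
begin

text \<open>Work with the columns of \<open>P\<close> as a finite family \<open>u\<close> of vectors, on which good matrices act by
  adding even multiples of one vector to another. If the integer span of \<open>u\<close> is dense, even
  Euclid turns a short integer combination with one odd coefficient into an arbitrarily short
  \<open>k\<close>-th vector \<open>b\<close> somewhere in the orbit. Projecting along \<open>b\<close> and inducting on the size of the family, the
  remaining vectors can be brought near any targets modulo \<open>\<real>b\<close>, and multiples of \<open>b\<close> correct the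
  rest. So the orbit closure contains all families with zero \<open>k\<close>-th vector, hence their orbits. These
  are dense, since density of the integer span forces every family in the space to satisfy a
  nontrivial linear relation.\<close>

section \<open>Orbits of vector families under even elementary operations\<close>

text \<open>Families are functions on the whole index type and only the indices in \<open>S\<close>
  take part, so an induction on \<open>S\<close> can freeze one vector while keeping the same
  function.\<close>

inductive orb :: "'i set \<Rightarrow> ('i \<Rightarrow> 'a::real_vector) \<Rightarrow> ('i \<Rightarrow> 'a) \<Rightarrow> bool"
  for S u where
  orb_refl: "orb S u u"
| orb_step: "orb S u v \<Longrightarrow> i \<in> S \<Longrightarrow> j \<in> S \<Longrightarrow> i \<noteq> j \<Longrightarrow> c = 2 \<or> c = -2 \<Longrightarrow>
    orb S u (v(j := v j + c *\<^sub>R v i))"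

lemma orb_trans:
  assumes "orb S u v" "orb S v w"
  shows "orb S u w"
  using assms(2,1) by induction (auto intro: orb_step)

lemma orb_single:
  assumes "i \<in> S" "j \<in> S" "i \<noteq> j" "c = 2 \<or> c = -2"
  shows "orb S u (u(j := u j + c *\<^sub>R u i))"
  using orb_step[OF orb_refl assms] .

lemma orb_sym:
  assumes "orb S u v"
  shows "orb S v u"
  using assms
proof induction
  case (orb_step v i j c)
  let ?w = "v(j := v j + c *\<^sub>R v i)"
  have "orb S ?w (?w(j := ?w j + (-c) *\<^sub>R ?w i))"
    using orb_step by (intro orb_single) auto
  moreover have "?w(j := ?w j + (-c) *\<^sub>R ?w i) = v"
    using orb_step by (auto simp: fun_eq_iff)
  ultimately show ?case
    using orb_step orb_trans by metis
qed (rule orb_refl)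

lemma orb_mono:
  assumes "orb S u v" "S \<subseteq> T"
  shows "orb T u v"
  using assms by induction (auto intro: orb.intros)

lemma orb_outside:
  assumes "orb S u v" "k \<notin> S"
  shows "v k = u k"
  using assms by induction auto

lemma orb_subspace:
  assumes "orb S u v" "subspace V" "\<And>i. i \<in> S \<Longrightarrow> u i \<in> V" "i \<in> S"
  shows "v i \<in> V"
  using assms(1,4)
  by (induction arbitrary: i) (auto simp: assms subspace_add subspace_scale)

text \<open>Steps commute with linear maps, so the steps performed on the image family can be
  repeated upstairs. This lifts orbits from a projection.\<close>

lemma orb_linear_lift:
  assumes "orb S (\<lambda>i. f (u i)) w" "linear f"
  shows "\<exists>v. orb S u v \<and> w = (\<lambda>i. f (v i))"
  using assms(1)
proof induction
  case (orb_step w i j c)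
  then obtain v where v: "orb S u v" "w = (\<lambda>i. f (v i))" by blast
  have "orb S u (v(j := v j + c *\<^sub>R v i))"
    using v orb_step by (intro orb.orb_step) auto
  moreover have "w(j := w j + c *\<^sub>R w i) = (\<lambda>l. f ((v(j := v j + c *\<^sub>R v i)) l))"
    using v assms(2) by (auto simp: fun_eq_iff linear_add linear_scale)
  ultimately show ?case by blast
qed (auto intro: orb_refl)

lemma orb_add_multiple:
  assumes "i \<in> S" "j \<in> S" "i \<noteq> j"
  shows "orb S u (u(j := u j + (2 * of_int m) *\<^sub>R u i))"
proof (induction m rule: int_induct[where k = 0])
  case base
  then show ?case by (simp add: orb_refl)
next
  case (step1 m)
  from orb_step[OF step1(2) assms, of 2] assms show ?case
    by (simp add: algebra_simps fun_upd_def cong: if_cong)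
next
  case (step2 m)
  from orb_step[OF step2(2) assms, of "-2"] assms show ?case
    by (simp add: algebra_simps fun_upd_def cong: if_cong)
qed

lemma orb_add_multiples:
  assumes "finite T" "T \<subseteq> S" "k \<in> S" "k \<notin> T"
  shows "orb S u (\<lambda>i. if i \<in> T then u i + (2 * of_int (m i)) *\<^sub>R u k else u i)"
  using assms
proof (induction T rule: finite_induct)
  case empty
  then show ?case by (simp add: orb_refl)
next
  case (insert j T)
  let ?v = "\<lambda>i. if i \<in> T then u i + (2 * of_int (m i)) *\<^sub>R u k else u i"
  have "orb S u (?v(j := ?v j + (2 * of_int (m j)) *\<^sub>R ?v k))"
    by (rule orb_trans[OF _ orb_add_multiple]) (use insert in auto)
  moreover have "?v(j := ?v j + (2 * of_int (m j)) *\<^sub>R ?v k) =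
      (\<lambda>i. if i \<in> insert j T then u i + (2 * of_int (m i)) *\<^sub>R u k else u i)"
    using insert by (auto simp: fun_eq_iff)
  ultimately show ?case by simp
qed

section \<open>Integer spans and even Euclid\<close>

definition zspan :: "'i set \<Rightarrow> ('i \<Rightarrow> 'a::real_vector) \<Rightarrow> 'a set" where
  "zspan S u = {\<Sum>i\<in>S. of_int (c i) *\<^sub>R u i | c :: 'i \<Rightarrow> int. True}"

text \<open>A step alters only two summands of a combination, so its invariance has to be checked
  only there.\<close>

lemma sum_two_changes:
  fixes f g :: "'i \<Rightarrow> 'a::ab_group_add"
  assumes "finite S" "i \<in> S" "j \<in> S" "i \<noteq> j" "\<And>l. l \<in> S \<Longrightarrow> l \<noteq> i \<Longrightarrow> l \<noteq> j \<Longrightarrow> f l = g l"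
    "f i + f j = g i + g j"
  shows "sum f S = sum g S"
proof -
  have "sum h S = h i + h j + sum h (S - {i, j})" for h :: "'i \<Rightarrow> 'a"
  proof -
    have "sum h S = sum h {i, j} + sum h (S - {i, j})"
      using assms by (metis sum.subset_diff add.commute bot.extremum insert_subset)
    then show ?thesis using assms by simp
  qed
  moreover have "sum f (S - {i, j}) = sum g (S - {i, j})"
    using assms by (intro sum.cong) auto
  ultimately show ?thesis using assms by metis
qed

text \<open>Adding \<open>c\<close> times \<open>v i\<close> to \<open>v j\<close> is compensated by
  lowering the coefficient at \<open>i\<close> by \<open>c\<close> times the one at
  \<open>j\<close>; it stays an integer. Hence density of the integer span persists along an
  orbit.\<close>

lemma zspan_orb_subset:
  assumes "orb S u v" "finite S"
  shows "zspan S u \<subseteq> zspan S v"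
  using assms(1)
proof induction
  case (orb_step v i j c)
  obtain c' :: int where c': "c = of_int c'"
    using orb_step by (metis of_int_minus of_int_numeral)
  have "zspan S v \<subseteq> zspan S (v(j := v j + c *\<^sub>R v i))"
  proof
    fix x assume "x \<in> zspan S v"
    then obtain a :: "_ \<Rightarrow> int" where x: "x = (\<Sum>l\<in>S. of_int (a l) *\<^sub>R v l)"
      by (auto simp: zspan_def)
    have "x = (\<Sum>l\<in>S. of_int ((a(i := a i - a j * c')) l) *\<^sub>R (v(j := v j + c *\<^sub>R v i)) l)"
      unfolding x using orb_step assms
      by (intro sum_two_changes[of S i j]) (auto simp: c' algebra_simps)
    then show "x \<in> zspan S (v(j := v j + c *\<^sub>R v i))"
      unfolding zspan_def by blast
  qed
  with orb_step show ?case by blast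
qed simp

text \<open>Euclid's algorithm with even quotients. Parity prevents it from getting stuck, as it would
  at two entries of the same nonzero absolute value.\<close>

lemma orb_even_euclid:
  fixes v :: "'i \<Rightarrow> int" and u :: "'i \<Rightarrow> 'a::real_vector"
  assumes "finite S" "k \<in> S" "odd (v k)" "\<And>i. i \<in> S \<Longrightarrow> i \<noteq> k \<Longrightarrow> even (v i)"
  shows "\<exists>u' m. orb S u u' \<and> m \<noteq> 0 \<and> (\<Sum>i\<in>S. of_int (v i) *\<^sub>R u i) = of_int m *\<^sub>R u' k"
  using assms(3,4)
proof (induction "nat (\<Sum>i\<in>S. \<bar>v i\<bar>)" arbitrary: v u rule: less_induct)
  case less
  show ?case
  proof (cases "\<exists>l\<in>S. l \<noteq> k \<and> v l \<noteq> 0")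
    case False
    then have "(\<Sum>i\<in>S. of_int (v i) *\<^sub>R u i) = (\<Sum>i\<in>{k}. of_int (v i) *\<^sub>R u i)"
      using assms by (intro sum.mono_neutral_right) auto
    moreover have "v k \<noteq> 0" using less by auto
    ultimately show ?thesis using orb_refl[of S u] by auto
  next
    case True
    then obtain l where l: "l \<in> S" "l \<noteq> k" "v l \<noteq> 0" by blast
    have "\<bar>v l\<bar> \<noteq> \<bar>v k\<bar>" using less.prems l by (metis even_abs_add_iff even_add dvd_abs_iff)
    moreover have "v k \<noteq> 0" using less by auto
    ultimately obtain i j where ij: "i \<in> S" "j \<in> S" "i \<noteq> j" "0 < \<bar>v i\<bar>" "\<bar>v i\<bar> < \<bar>v j\<bar>"
      using l assms(2) by (metis linorder_neqE zero_less_abs_iff)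
    \<comment> \<open>The sign makes \<open>s * v i\<close> agree in sign with \<open>v j\<close>;
      as \<open>0 < \<bar>v i\<bar> < \<bar>v j\<bar>\<close>, subtracting it twice strictly shrinks
      \<open>\<bar>v j\<bar>\<close>.\<close>
    define s :: int where "s = sgn (v i) * sgn (v j)"
    have s: "s = 1 \<or> s = -1" "\<bar>v j - 2 * s * v i\<bar> < \<bar>v j\<bar>"
      using ij by (auto simp: s_def sgn_if)
    define v' where "v' = v(j := v j - 2 * s * v i)"
    \<comment> \<open>The dual operation on the vectors: the change at \<open>i\<close> offsets the
      change of the coefficient at \<open>j\<close>, so the combination keeps its value.\<close>
    define u1 where "u1 = u(i := u i + (2 * of_int s) *\<^sub>R u j)"
    have "(\<Sum>l\<in>S. \<bar>v' l\<bar>) < (\<Sum>l\<in>S. \<bar>v l\<bar>)"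
      using assms(1) ij s by (intro sum_strict_mono_ex1) (auto simp: v'_def)
    moreover have "0 \<le> (\<Sum>l\<in>S. \<bar>v' l\<bar>)" by (intro sum_nonneg) auto
    ultimately have lt: "nat (\<Sum>l\<in>S. \<bar>v' l\<bar>) < nat (\<Sum>l\<in>S. \<bar>v l\<bar>)" by linarith
    have "odd (v' k)" using less.prems by (auto simp: v'_def)
    moreover have "even (v' l)" if "l \<in> S" "l \<noteq> k" for l
      using less.prems that by (auto simp: v'_def)
    ultimately obtain u' m where u': "orb S u1 u'" "m \<noteq> 0"
      "(\<Sum>i\<in>S. of_int (v' i) *\<^sub>R u1 i) = of_int m *\<^sub>R u' k"
      using less.hyps[OF lt] by blast
    have "orb S u u1"
      unfolding u1_def using ij by (intro orb_add_multiple) auto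
    moreover have "(\<Sum>i\<in>S. of_int (v i) *\<^sub>R u i) = (\<Sum>i\<in>S. of_int (v' i) *\<^sub>R u1 i)"
      using ij assms(1)
      by (intro sum_two_changes[of S i j]) (auto simp: v'_def u1_def algebra_simps)
    ultimately show ?thesis using u' orb_trans by metis
  qed
qed

text \<open>Approximate \<open>- u k / 2\<close> by an integer combination, double it and add
  \<open>u k\<close>: the result is short, with an odd coefficient at \<open>k\<close> and even ones
  elsewhere. Even Euclid turns it into a nonzero integer multiple of a \<open>k\<close>-th vector in
  the orbit, which is no longer than the multiple.\<close>

lemma orb_small_entry:
  fixes u :: "'i \<Rightarrow> 'a::real_normed_vector"
  assumes "finite S" "k \<in> S" "subspace V" "u k \<in> V" "V \<subseteq> closure (zspan S u)" "e > 0"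
  shows "\<exists>u'. orb S u u' \<and> norm (u' k) < e"
proof -
  have "(-1/2) *\<^sub>R u k \<in> closure (zspan S u)"
    using assms subspace_scale by blast
  then obtain y where y: "y \<in> zspan S u" "dist y ((-1/2) *\<^sub>R u k) < e / 2"
    using assms(6) by (meson closure_approachable half_gt_zero)
  then obtain c :: "'i \<Rightarrow> int" where c: "y = (\<Sum>i\<in>S. of_int (c i) *\<^sub>R u i)"
    by (auto simp: zspan_def)
  define v where "v = (\<lambda>i. 2 * c i + (if i = k then 1 else 0))"
  obtain u' m where u': "orb S u u'" "m \<noteq> 0"
    "(\<Sum>i\<in>S. of_int (v i) *\<^sub>R u i) = of_int m *\<^sub>R u' k"
    using orb_even_euclid[of S k v u] assms by (auto simp: v_def)
  have "of_int (v i) *\<^sub>R u i = 2 *\<^sub>R (of_int (c i) *\<^sub>R u i) + (if i = k then u i else 0)" for i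
    by (simp add: v_def algebra_simps)
  then have "(\<Sum>i\<in>S. of_int (v i) *\<^sub>R u i) = 2 *\<^sub>R y + u k"
    using assms(1,2) by (simp add: c sum.distrib scaleR_right.sum)
  also have "\<dots> = 2 *\<^sub>R (y - (-1/2) *\<^sub>R u k)" by (simp add: algebra_simps)
  finally have "norm (of_int m *\<^sub>R u' k) < e"
    using y(2) by (simp only: u'(3)[symmetric] norm_scaleR) (simp add: dist_norm)
  moreover have "norm (u' k) \<le> norm (of_int m *\<^sub>R u' k)"
  proof -
    have "1 \<le> \<bar>real_of_int m\<bar>" using u'(2) by linarith
    from mult_right_mono[OF this norm_ge_zero] show ?thesis by simp
  qed
  ultimately show ?thesis using u'(1) by auto
qed

section \<open>Orbit closures\<close>

text \<open>Membership of \<open>q\<close> in the closure of the orbit of \<open>u\<close>, for the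
  uniform distance over the indices in \<open>S\<close>.\<close>

definition adherent :: "'i set \<Rightarrow> ('i \<Rightarrow> 'a::real_normed_vector) \<Rightarrow> ('i \<Rightarrow> 'a) \<Rightarrow> bool" where
  "adherent S u q \<longleftrightarrow> (\<forall>e>0. \<exists>v. orb S u v \<and> (\<forall>i\<in>S. norm (v i - q i) < e))"

text \<open>Each step is a continuous map that sends the orbit into itself, so it preserves the
  closure.\<close>

lemma adherent_orb:
  assumes "orb S q q'" "adherent S u q"
  shows "adherent S u q'"
  using assms
proof induction
  case (orb_step q i j c)
  then have q: "adherent S u q" by blast
  show ?case
    unfolding adherent_def
  proof (intro allI impI)
    fix e :: real assume "e > 0"
    \<comment> \<open>One third covers the error at \<open>j\<close>, two thirds cover the error at
      \<open>i\<close>, which is doubled because \<open>\<bar>c\<bar> = 2\<close>.\<close>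
    then have "e / 3 > 0" by simp
    with q obtain v where v: "orb S u v" "\<And>l. l \<in> S \<Longrightarrow> norm (v l - q l) < e / 3"
      unfolding adherent_def by meson
    let ?v = "v(j := v j + c *\<^sub>R v i)"
    have "norm (?v l - (q(j := q j + c *\<^sub>R q i)) l) < e" if "l \<in> S" for l
    proof (cases "l = j")
      case True
      have "norm (c *\<^sub>R (v i - q i)) = 2 * norm (v i - q i)"
        using orb_step.hyps(5) by auto
      then have "norm ((v j - q j) + c *\<^sub>R (v i - q i)) \<le> norm (v j - q j) + 2 * norm (v i - q i)"
        using norm_triangle_ineq[of "v j - q j" "c *\<^sub>R (v i - q i)"] by linarith
      also have "\<dots> < e"
        using v(2)[OF orb_step.hyps(2)] v(2)[OF orb_step.hyps(3)] by simp
      finally show ?thesis using True by (simp add: algebra_simps)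
    next
      case False
      then show ?thesis using v(2)[OF that] \<open>e > 0\<close> by simp
    qed
    moreover have "orb S u ?v" using v(1) orb_step.hyps(2-5) by (rule orb.orb_step)
    ultimately show "\<exists>v. orb S u v \<and> (\<forall>l\<in>S. norm (v l - (q(j := q j + c *\<^sub>R q i)) l) < e)"
      by blast
  qed
qed simp

lemma adherent_closed:
  assumes "\<And>e. e > 0 \<Longrightarrow> \<exists>q'. adherent S u q' \<and> (\<forall>i\<in>S. norm (q' i - q i) < e)"
  shows "adherent S u q"
  unfolding adherent_def
proof safe
  fix e :: real assume "e > 0"
  then have e: "e / 2 > 0" by simp
  obtain q' where q': "adherent S u q'" "\<And>i. i \<in> S \<Longrightarrow> norm (q' i - q i) < e / 2"
    using assms[OF e] by blast
  then obtain v where v: "orb S u v" "\<And>i. i \<in> S \<Longrightarrow> norm (v i - q' i) < e / 2"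
    using e unfolding adherent_def by meson
  have "norm (v i - q i) < e" if "i \<in> S" for i
    using norm_triangle_lt[of "v i - q' i" "q' i - q i" e] v(2)[OF that] q'(2)[OF that] by simp
  then show "\<exists>v. orb S u v \<and> (\<forall>i\<in>S. norm (v i - q i) < e)" using v by blast
qed

section \<open>Linear relations forced by density\<close>

text \<open>Independence of the image set ignores repetitions, so injectivity is derived separately:
  two equal vectors satisfy the relation with coefficients 1 and -1.\<close>

lemma independent_family:
  fixes f :: "'i \<Rightarrow> 'a::real_vector"
  assumes "finite S" "\<And>w. (\<Sum>i\<in>S. w i *\<^sub>R f i) = 0 \<Longrightarrow> \<forall>i\<in>S. w i = 0"
  shows "inj_on f S" "independent (f ` S)"
proof -
  show inj: "inj_on f S"
  proof (rule inj_onI, rule ccontr)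
    fix i j assume ij: "i \<in> S" "j \<in> S" "f i = f j" "i \<noteq> j"
    let ?w = "(\<lambda>l. 0 :: real)(i := 1, j := -1)"
    have "(\<Sum>l\<in>S. ?w l *\<^sub>R f l) = (\<Sum>l\<in>S. 0)"
      using ij assms(1) by (intro sum_two_changes[of S i j]) auto
    then have "?w i = 0" using assms(2)[of ?w] ij(1) by simp
    with ij(4) show False by simp
  qed
  show "independent (f ` S)"
  proof
    assume "dependent (f ` S)"
    then obtain w where w: "\<exists>x\<in>f ` S. w x \<noteq> 0" "(\<Sum>x\<in>f ` S. w x *\<^sub>R x) = 0"
      using assms(1) by (auto simp: dependent_finite)
    have "(\<Sum>i\<in>S. (w \<circ> f) i *\<^sub>R f i) = 0"
      using w(2) inj by (simp add: sum.reindex)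
    from assms(2)[OF this] w(1) show False by auto
  qed
qed

lemma zspan_subset_span: "zspan S u \<subseteq> span (u ` S)"
  by (auto simp: zspan_def intro!: span_sum intro: span_scale span_base)

text \<open>The functional dual to \<open>u k\<close> is continuous and takes integer values on the
  integer span, so it cannot equal 1/2 at a point of the closure.\<close>

lemma zspan_independent_not_dense:
  fixes u :: "'i \<Rightarrow> 'a::euclidean_space"
  assumes "finite S" "inj_on u S" "independent (u ` S)" "k \<in> S"
  shows "(1/2) *\<^sub>R u k \<notin> closure (zspan S u)"
proof
  assume *: "(1/2) *\<^sub>R u k \<in> closure (zspan S u)"
  obtain g :: "'a \<Rightarrow> real" where g: "linear g" "\<forall>x\<in>u ` S. g x = (if x = u k then 1 else 0)"
    using linear_independent_extend[OF assms(3), of "\<lambda>x. if x = u k then 1 else 0"] by blast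
  obtain B where B: "B > 0" "\<And>x. norm (g x) \<le> B * norm x"
    using linear_bounded_pos[OF g(1)] by blast
  have "1 / (2 * B) > 0" using B(1) by simp
  then obtain y where y: "y \<in> zspan S u" "dist y ((1/2) *\<^sub>R u k) < 1 / (2 * B)"
    using * unfolding closure_approachable by blast
  then obtain c :: "'i \<Rightarrow> int" where c: "y = (\<Sum>i\<in>S. of_int (c i) *\<^sub>R u i)"
    by (auto simp: zspan_def)
  have "g y = (\<Sum>i\<in>S. of_int (c i) * g (u i))"
    by (simp add: c linear_sum[OF g(1)] linear_scale[OF g(1)])
  also have "\<dots> = (\<Sum>i\<in>S. if i = k then of_int (c i) else 0)"
    using g(2) assms(2,4) by (intro sum.cong) (simp_all add: inj_on_eq_iff)
  also have "\<dots> = of_int (c k)" using assms by simp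
  finally have "g (y - (1/2) *\<^sub>R u k) = of_int (c k) - 1/2"
    using g(2) assms(4) by (simp add: linear_diff[OF g(1)] linear_scale[OF g(1)])
  moreover have "norm (g (y - (1/2) *\<^sub>R u k)) < 1/2"
  proof -
    have "norm (g (y - (1/2) *\<^sub>R u k)) \<le> B * norm (y - (1/2) *\<^sub>R u k)" by (rule B)
    also have "\<dots> < 1/2" using y(2) B(1) by (simp add: dist_norm field_simps)
    finally show ?thesis .
  qed
  ultimately have "\<bar>real_of_int (c k) - 1/2\<bar> < 1/2" by simp
  then have "0 < c k \<and> c k < 1" by linarith
  then show False by presburger
qed

text \<open>Without a relation among the \<open>q i\<close>, the dimension of \<open>V\<close> is at
  least \<open>card S\<close>. Spans are closed, so \<open>u\<close> spans \<open>V\<close>; by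
  counting, \<open>u\<close> is then injective on \<open>S\<close> with independent image, and its
  integer span stays away from \<open>u k / 2\<close>.\<close>

lemma dense_zspan_relation:
  fixes u q :: "'i \<Rightarrow> 'a::euclidean_space"
  assumes "finite S" "subspace V" "\<And>i. i \<in> S \<Longrightarrow> u i \<in> V" "V \<subseteq> closure (zspan S u)"
    "S \<noteq> {}" "\<And>i. i \<in> S \<Longrightarrow> q i \<in> V"
  shows "\<exists>w. (\<exists>l\<in>S. w l \<noteq> 0) \<and> (\<Sum>i\<in>S. w i *\<^sub>R q i) = 0"
proof (rule ccontr)
  assume *: "\<nexists>w. (\<exists>l\<in>S. w l \<noteq> 0) \<and> (\<Sum>i\<in>S. w i *\<^sub>R q i) = 0"
  have "inj_on q S" and q: "independent (q ` S)"
    using independent_family[of S q] * assms(1) by blast+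
  then have "card S = card (q ` S)" by (simp add: card_image)
  also have "\<dots> \<le> dim V"
    using q assms by (intro independent_card_le_dim) auto
  finally have card: "card S \<le> dim V" .
  have V: "V \<subseteq> span (u ` S)"
    using assms(4) closure_minimal[OF zspan_subset_span closed_span] by (metis subset_trans)
  have "card (u ` S) \<le> card S" using assms(1) by (rule card_image_le)
  moreover have "dim V \<le> card (u ` S)"
    using V assms(1) by (simp add: dim_le_card)
  ultimately have eq: "card (u ` S) = card S" "card (u ` S) \<le> dim V" using card by simp_all
  have "independent (u ` S)"
    using assms(1,3) V eq by (intro card_le_dim_spanning[of "u ` S" V]) auto
  moreover have "inj_on u S" using eq(1) assms(1) by (simp add: eq_card_imp_inj_on)
  moreover obtain k where k: "k \<in> S" using assms(5) by blast
  ultimately have "(1/2) *\<^sub>R u k \<notin> closure (zspan S u)"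
    using assms(1) by (intro zspan_independent_not_dense)
  moreover have "(1/2) *\<^sub>R u k \<in> V" using assms(2) assms(3)[OF k] by (rule subspace_scale)
  ultimately show False using assms(4) by blast
qed

section \<open>Approximating real relations by integer ones\<close>

text \<open>Rounding error and shift \<open>b\<close> stay bounded, so they vanish after division by
  \<open>n\<close>. Taking \<open>b\<close> as 0 or 1 prescribes the parity of the approximating
  integers.\<close>

lemma floor_multiple_tendsto:
  fixes a b :: real
  shows "(\<lambda>n. (2 * of_int \<lfloor>real n * a\<rfloor> + b) / real n) \<longlonglongrightarrow> 2 * a"
proof (rule Lim_transform2)
  show "(\<lambda>n. 2 * a :: real) \<longlonglongrightarrow> 2 * a" by simp
  have "norm (2 * a - (2 * of_int \<lfloor>real n * a\<rfloor> + b) / real n) \<le> (2 + \<bar>b\<bar>) / real n"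
    if n: "1 \<le> n" for n :: nat
  proof -
    have *: "\<bar>2 * x - b\<bar> \<le> 2 + \<bar>b\<bar>" if "0 \<le> x" "x \<le> 1" for x :: real
      using that by linarith
    have "\<bar>2 * (real n * a - of_int \<lfloor>real n * a\<rfloor>) - b\<bar> \<le> 2 + \<bar>b\<bar>"
      by (rule *) linarith+
    moreover have "2 * a - (2 * of_int \<lfloor>real n * a\<rfloor> + b) / real n =
        (2 * (real n * a - of_int \<lfloor>real n * a\<rfloor>) - b) / real n"
      using n by (simp add: field_simps)
    ultimately show ?thesis
      by (simp only: real_norm_def abs_divide abs_of_nat divide_right_mono of_nat_0_le_iff)
  qed
  then have "\<forall>\<^sub>F n in sequentially.
      norm (2 * a - (2 * of_int \<lfloor>real n * a\<rfloor> + b) / real n) \<le> (2 + \<bar>b\<bar>) / real n"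
    by (rule eventually_sequentiallyI)
  then show "(\<lambda>n. 2 * a - (2 * of_int \<lfloor>real n * a\<rfloor> + b) / real n) \<longlonglongrightarrow> 0"
    using lim_const_over_n by (rule Lim_null_comparison)
qed

text \<open>A real relation between the entries of \<open>q\<close> is approximated by relations whose coefficient
  vector is congruent to the \<open>k\<close>-th unit vector modulo 2; these come from families that have a zero
  at \<open>k\<close> somewhere in their orbit.\<close>

lemma perturb_to_zero_entry:
  fixes q :: "'i \<Rightarrow> 'a::real_normed_vector"
  assumes "finite S" "k \<in> S" "subspace V" "\<And>i. i \<in> S \<Longrightarrow> q i \<in> V" "e > 0"
    "l \<in> S" "w l \<noteq> 0" "(\<Sum>i\<in>S. w i *\<^sub>R q i) = 0"
  shows "\<exists>q' q''. orb S q' q'' \<and> q'' k = 0 \<and> (\<forall>i\<in>S. q' i \<in> V) \<and> (\<forall>i\<in>S. norm (q' i - q i) < e)"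
proof -
  define v where "v = (\<lambda>n i. 2 * \<lfloor>real n * w i\<rfloor> + (if i = k then 1 else 0 :: int))"
  define x where "x = (\<lambda>n. (\<Sum>i\<in>S. of_int (v n i) *\<^sub>R q i))"
  have lim: "(\<lambda>n. of_int (v n i) / real n) \<longlonglongrightarrow> 2 * w i" for i
    using floor_multiple_tendsto[of "w i" "if i = k then 1 else 0"] by (cases "i = k") (auto simp: v_def)
  have "(\<lambda>n. \<Sum>i\<in>S. (of_int (v n i) / real n) *\<^sub>R q i) \<longlonglongrightarrow> (\<Sum>i\<in>S. (2 * w i) *\<^sub>R q i)"
    by (intro tendsto_intros lim)
  also have "(\<Sum>i\<in>S. (2 * w i) *\<^sub>R q i) = 2 *\<^sub>R (\<Sum>i\<in>S. w i *\<^sub>R q i)"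
    by (simp add: scaleR_right.sum)
  finally have "(\<lambda>n. \<Sum>i\<in>S. (of_int (v n i) / real n) *\<^sub>R q i) \<longlonglongrightarrow> 0"
    using assms(8) by simp
  \<comment> \<open>The factor \<open>n\<close> cancels here: the sequence is \<open>x n\<close>
    divided by \<open>v n l\<close>, the correction made below at index \<open>l\<close>. It tends
    to 0 because the limit \<open>2 * w l\<close> is nonzero.\<close>
  then have "(\<lambda>n. inverse (of_int (v n l) / real n) *\<^sub>R (\<Sum>i\<in>S. (of_int (v n i) / real n) *\<^sub>R q i))
      \<longlonglongrightarrow> inverse (2 * w l) *\<^sub>R 0"
    using assms(7) by (intro tendsto_intros lim) auto
  then have "\<forall>\<^sub>F n in sequentially.
      norm (inverse (of_int (v n l) / real n) *\<^sub>R (\<Sum>i\<in>S. (of_int (v n i) / real n) *\<^sub>R q i)) < e"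
    using assms(5) by (auto simp: tendsto_iff dist_norm)
  \<comment> \<open>As division by 0 yields 0, a nonzero quotient ensures that both \<open>n\<close>
    and \<open>v n l\<close> are nonzero.\<close>
  moreover have "\<forall>\<^sub>F n in sequentially. of_int (v n l) / real n \<noteq> 0"
    using tendsto_imp_eventually_ne[OF lim[of l], of 0] assms(7) by simp
  ultimately have "\<forall>\<^sub>F n in sequentially. of_int (v n l) / real n \<noteq> 0 \<and>
      norm (inverse (of_int (v n l) / real n) *\<^sub>R (\<Sum>i\<in>S. (of_int (v n i) / real n) *\<^sub>R q i)) < e"
    by eventually_elim auto
  then obtain n where n: "of_int (v n l) / real n \<noteq> 0"
      "norm (inverse (of_int (v n l) / real n) *\<^sub>R (\<Sum>i\<in>S. (of_int (v n i) / real n) *\<^sub>R q i)) < e"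
    using eventually_happens' sequentially_bot by blast
  have "(\<Sum>i\<in>S. (of_int (v n i) / real n) *\<^sub>R q i) = (1 / real n) *\<^sub>R x n"
    by (simp add: x_def scaleR_right.sum)
  with n have n': "v n l \<noteq> 0" "norm ((1 / of_int (v n l)) *\<^sub>R x n) < e"
    by (auto simp: field_simps)
  \<comment> \<open>This correction makes \<open>v n\<close> an exact relation of \<open>q'\<close>,
    so even Euclid gives a nonzero multiple of \<open>q'' k\<close> that vanishes.\<close>
  define q' where "q' = q(l := q l - (1 / of_int (v n l)) *\<^sub>R x n)"
  have xV: "x n \<in> V" unfolding x_def
    using assms by (intro subspace_sum subspace_scale) auto
  have "(\<Sum>i\<in>S. of_int (v n i) *\<^sub>R q' i) =
      (\<Sum>i\<in>S. of_int (v n i) *\<^sub>R q i - (if i = l then x n else 0))"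
    using n' by (intro sum.cong) (auto simp: q'_def algebra_simps)
  also have "\<dots> = 0" using assms by (simp add: sum_subtractf x_def)
  finally have 0: "(\<Sum>i\<in>S. of_int (v n i) *\<^sub>R q' i) = 0" .
  obtain q'' m where q'': "orb S q' q''" "m \<noteq> 0"
    "(\<Sum>i\<in>S. of_int (v n i) *\<^sub>R q' i) = of_int m *\<^sub>R q'' k"
    using orb_even_euclid[of S k "v n" q'] assms by (auto simp: v_def)
  have "q'' k = 0" using q'' 0 by simp
  moreover have "\<forall>i\<in>S. q' i \<in> V"
    using assms xV by (auto simp: q'_def intro!: subspace_diff subspace_scale)
  moreover have "\<forall>i\<in>S. norm (q' i - q i) < e"
    using n'(2) assms(5) by (auto simp: q'_def)
  ultimately show ?thesis using q''(1) by blast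
qed

section \<open>Density of orbits by induction on the family\<close>

text \<open>The ambient space is an arbitrary subspace \<open>V\<close> because the induction passes
  to the image of \<open>V\<close> under a projection.\<close>

theorem dense_zspan_adherent:
  fixes u q :: "'i \<Rightarrow> 'a::euclidean_space"
  assumes "finite S" "subspace V" "\<And>i. i \<in> S \<Longrightarrow> u i \<in> V" "V \<subseteq> closure (zspan S u)"
    "\<And>i. i \<in> S \<Longrightarrow> q i \<in> V"
  shows "adherent S u q"
  using assms
proof (induction S arbitrary: V u q rule: finite_induct)
  case empty
  then show ?case by (auto simp: adherent_def intro: orb_refl)
next
  case (insert k S)
  let ?S = "insert k S"
  have fin: "finite ?S" using insert by simp
  have zero_entry: "adherent ?S u r" if r: "r k = 0" "\<And>i. i \<in> ?S \<Longrightarrow> r i \<in> V" for r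
    unfolding adherent_def
  proof safe
    fix e :: real assume e: "e > 0"
    obtain u' where u': "orb ?S u u'" "norm (u' k) < e / 2"
      using orb_small_entry[of ?S k V u "e / 2"] insert.prems fin e by auto
    define b where "b = u' k"
    \<comment> \<open>Orthogonal projection along \<open>b\<close>. If \<open>b = 0\<close>, the
      quotient is 0 and \<open>p\<close> is the identity, which the argument tolerates.\<close>
    define p where "p = (\<lambda>x. x - (x \<bullet> b / (b \<bullet> b)) *\<^sub>R b)"
    have p: "linear p"
      by (rule linearI) (auto simp: p_def inner_add_left add_divide_distrib algebra_simps)
    have pb: "p b = 0" by (simp add: p_def)
    have V': "u' i \<in> V" if "i \<in> ?S" for i
      using orb_subspace[OF u'(1)] insert.prems that by blast
    \<comment> \<open>Density survives the continuous map \<open>p\<close>, and \<open>p\<close>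
      kills \<open>u' k\<close>, so the index \<open>k\<close> drops out of the integer
      span.\<close>
    have "p ` V \<subseteq> closure (zspan S (\<lambda>i. p (u' i)))"
    proof -
      have "p ` V \<subseteq> p ` closure (zspan ?S u')"
        using insert.prems(3) closure_mono[OF zspan_orb_subset[OF u'(1) fin]] by blast
      also have "\<dots> \<subseteq> closure (p ` zspan ?S u')"
        using p by (intro image_closure_subset closed_closure closure_subset)
          (auto intro: linear_continuous_on simp: linear_conv_bounded_linear)
      also have "p ` zspan ?S u' \<subseteq> zspan S (\<lambda>i. p (u' i))"
        using insert.hyps p pb
        by (auto simp: zspan_def linear_sum linear_add linear_scale b_def)
      finally show ?thesis using closure_mono by blast
    qed
    moreover have "subspace (p ` V)" using p insert.prems(1) by (rule linear_subspace_image)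
    ultimately have "adherent S (\<lambda>i. p (u' i)) (\<lambda>i. p (r i))"
      using V' r by (intro insert.IH[of "p ` V"]) auto
    then obtain w where w: "orb S (\<lambda>i. p (u' i)) w" "\<And>i. i \<in> S \<Longrightarrow> norm (w i - p (r i)) < e / 2"
      using e unfolding adherent_def by (meson half_gt_zero)
    obtain v where v: "orb S u' v" "w = (\<lambda>i. p (v i))"
      using orb_linear_lift[OF w(1) p] by blast
    have vk: "v k = b" using orb_outside[OF v(1)] insert.hyps by (simp add: b_def)
    \<comment> \<open>\<open>c i\<close> is the coordinate along \<open>b\<close> of the error at
      \<open>i\<close>, and \<open>- 2 * m i\<close> is an even integer nearest to it. Adding
      \<open>2 * m i\<close> copies of \<open>b\<close> leaves at most \<open>norm b\<close>, below
      \<open>e / 2\<close>.\<close>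
    define c where "c = (\<lambda>i. (v i - r i) \<bullet> b / (b \<bullet> b))"
    define m where "m = (\<lambda>i. - \<lfloor>(c i + 1) / 2\<rfloor>)"
    define z where "z = (\<lambda>i. if i \<in> S then v i + (2 * of_int (m i)) *\<^sub>R v k else v i)"
    have "orb ?S v z"
      unfolding z_def using insert.hyps by (intro orb_add_multiples) auto
    then have "orb ?S u z"
      using orb_trans[OF u'(1) orb_trans[OF orb_mono[OF v(1) subset_insertI]]] by blast
    moreover have "norm (z i - r i) < e" if "i \<in> ?S" for i
    proof (cases "i \<in> S")
      case True
      have "v i - r i = p (v i - r i) + c i *\<^sub>R b" by (simp add: p_def c_def)
      then have "z i - r i = p (v i - r i) + (c i + 2 * of_int (m i)) *\<^sub>R b"
        using True by (simp add: z_def vk algebra_simps)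
      moreover have "norm (p (v i - r i)) < e / 2"
        using w(2)[OF True] p by (simp add: v(2) linear_diff)
      moreover have "norm ((c i + 2 * of_int (m i)) *\<^sub>R b) \<le> norm b"
      proof -
        have "of_int \<lfloor>(c i + 1) / 2\<rfloor> \<le> (c i + 1) / 2" "(c i + 1) / 2 < of_int \<lfloor>(c i + 1) / 2\<rfloor> + 1"
          by linarith+
        then have "\<bar>c i + 2 * of_int (m i)\<bar> \<le> 1" by (simp add: m_def abs_le_iff field_simps)
        from mult_right_mono[OF this norm_ge_zero] show ?thesis by simp
      qed
      ultimately show ?thesis
        using u'(2) norm_triangle_lt[of "p (v i - r i)" "(c i + 2 * of_int (m i)) *\<^sub>R b" e]
        by (simp add: b_def)
    next
      case False
      then have "i = k" using that by simp
      then show ?thesis using False u'(2) r e by (simp add: z_def vk b_def)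
    qed
    ultimately show "\<exists>v. orb ?S u v \<and> (\<forall>i\<in>?S. norm (v i - r i) < e)" by blast
  qed
  \<comment> \<open>A general target \<open>q\<close> is a limit of families \<open>q'\<close> with
    some \<open>q''\<close> in their orbit vanishing at \<open>k\<close>. Such \<open>q''\<close>
    are adherent by \<open>zero_entry\<close>, and reversing the orbit carries this to
    \<open>q'\<close>.\<close>
  show ?case
  proof (rule adherent_closed)
    fix e :: real assume e: "e > 0"
    obtain w l where w: "l \<in> ?S" "w l \<noteq> 0" "(\<Sum>i\<in>?S. w i *\<^sub>R q i) = 0"
      using dense_zspan_relation[of ?S V u q] insert.prems fin by auto
    obtain q' q'' where q: "orb ?S q' q''" "q'' k = 0" "\<forall>i\<in>?S. q' i \<in> V"
        "\<forall>i\<in>?S. norm (q' i - q i) < e"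
      using perturb_to_zero_entry[of ?S k V q e l w] fin insert.prems e w by blast
    have "adherent ?S u q''"
      using zero_entry q orb_subspace[OF q(1) insert.prems(1)] by blast
    then have "adherent ?S u q'"
      using adherent_orb orb_sym q(1) by blast
    then show "\<exists>q'. adherent ?S u q' \<and> (\<forall>i\<in>?S. norm (q' i - q i) < e)"
      using q by blast
  qed
qed

section \<open>Step matrices, columns and norms\<close>

definition step_matrix :: "'n \<Rightarrow> 'n \<Rightarrow> real \<Rightarrow> real ^ 'n ^ 'n" where
  "step_matrix i j c = (\<chi> k l. if k = i \<and> l = j then c else mat 1 $ k $ l)"

text \<open>This is the link to \<open>orb\<close>: right multiplication by a step matrix performs
  one step on the family of columns.\<close>

lemma column_mult_step_matrix:
  fixes B :: "real ^ 'n ^ 'd"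
  assumes "i \<noteq> j"
  shows "column l (B ** step_matrix i j c) =
    (if l = j then column j B + c *\<^sub>R column i B else column l B)"
proof -
  have "(\<Sum>k\<in>UNIV. B $ a $ k * step_matrix i j c $ k $ l) =
      B $ a $ l + (if l = j then c * B $ a $ i else 0)" for a
  proof -
    have "(\<Sum>k\<in>UNIV. B $ a $ k * step_matrix i j c $ k $ l) =
      (\<Sum>k\<in>UNIV. (if k = l then B $ a $ k else 0) + (if k = i then if l = j then c * B $ a $ i else 0 else 0))"
      using assms by (intro sum.cong) (auto simp: step_matrix_def mat_def)
    then show ?thesis by (simp add: sum.distrib)
  qed
  then show ?thesis by (simp add: vec_eq_iff column_def matrix_matrix_mult_def)
qed

lemma step_matrix_mult_inverse:
  assumes "i \<noteq> j"
  shows "step_matrix i j c ** step_matrix i j (- c) = mat 1"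
proof -
  have "column l (step_matrix i j c ** step_matrix i j (- c)) = column l (mat 1)" for l
    using assms by (auto simp: column_mult_step_matrix)
      (auto simp: vec_eq_iff column_def step_matrix_def mat_def)
  then show ?thesis by (simp add: vec_eq_iff column_def)
qed

lemma step_matrices_eq:
  "step_matrices = {step_matrix i j c | i j c. i \<noteq> j \<and> (c = 2 \<or> c = -2)}"
  by (simp add: step_matrices_def step_matrix_def)

lemma inv_step_matrix:
  assumes "i \<noteq> j"
  shows "inv\<^bsub>GL\<^esub> (step_matrix i j c) = step_matrix i j (- c)"
proof (rule group.inv_equality[OF group_GL])
  have *: "step_matrix i j c ** step_matrix i j (- c) = mat 1" for c
    using step_matrix_mult_inverse[OF assms] .
  from *[of c] *[of "- c"] show "step_matrix i j (- c) \<otimes>\<^bsub>GL\<^esub> step_matrix i j c = \<one>\<^bsub>GL\<^esub>"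
    "step_matrix i j c \<in> carrier GL" "step_matrix i j (- c) \<in> carrier GL"
    by (auto simp: GL_def invertible_def)
qed

text \<open>Integrality survives the inverses of generators because these are again step matrices,
  with \<open>c\<close> negated.\<close>

lemma good_integer_entries:
  assumes "good A"
  shows "A $ a $ b \<in> \<int>"
  using assms unfolding good_def
proof (induction arbitrary: a b)
  case one
  then show ?case by (simp add: GL_def mat_def)
next
  case (incl h)
  then show ?case by (auto simp: step_matrices_eq step_matrix_def mat_def)
next
  case (inv h)
  then show ?case by (auto simp: step_matrices_eq inv_step_matrix) (auto simp: step_matrix_def mat_def)
next
  case (eng h1 h2)
  then show ?case by (auto simp: GL_def matrix_matrix_mult_def intro!: Ints_sum Ints_mult)
qed

text \<open>Each step on the columns appends a step matrix on the right of the good matrix found so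
  far.\<close>

lemma orb_columns_good:
  fixes P :: "real ^ 'n ^ 'd"
  assumes "orb UNIV (\<lambda>j. column j P) v"
  shows "\<exists>A. good A \<and> v = (\<lambda>j. column j (P ** A))"
  using assms
proof induction
  case orb_refl
  have "good (mat 1 :: real ^ 'n ^ 'n)"
    using generate.one[of GL] by (simp add: good_def GL_def)
  then show ?case by (metis matrix_mul_rid)
next
  case (orb_step v i j c)
  then obtain A where A: "good A" "v = (\<lambda>j. column j (P ** A))" by blast
  have "step_matrix i j c \<in> generate GL step_matrices"
    using orb_step by (intro generate.incl) (auto simp: step_matrices_eq)
  with A(1) have "good (A ** step_matrix i j c)"
    using generate.eng[of A GL _ "step_matrix i j c"] by (simp add: good_def GL_def)
  moreover have "v(j := v j + c *\<^sub>R v i) = (\<lambda>l. column l (P ** (A ** step_matrix i j c)))"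
    using A(2) orb_step by (auto simp: fun_eq_iff matrix_mul_assoc column_mult_step_matrix)
  ultimately show ?case by blast
qed

lemma G_eq_zspan: "G P = zspan UNIV (\<lambda>j. column j P)"
proof -
  have "P *v (\<chi> i. of_int (c i)) = (\<Sum>i\<in>UNIV. of_int (c i) *\<^sub>R column i P)" for c
    by (simp add: matrix_mult_sum scalar_mult_eq_scaleR)
  moreover have "\<exists>c. v = (\<chi> i. of_int (c i))" if "\<forall>i. v $ i \<in> \<int>" for v :: "real ^ 'b"
    using that by (intro exI[of _ "\<lambda>i. \<lfloor>v $ i\<rfloor>"]) (simp add: vec_eq_iff)
  ultimately show ?thesis unfolding G_def zspan_def
    by (auto, metis, metis Ints_of_int vec_lambda_beta)
qed

text \<open>The matrix norm is the Euclidean norm of the vector of row norms, and each entry of the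
  column is bounded by the norm of its row.\<close>

lemma norm_column_le: "norm (column j M) \<le> norm (M :: real ^ 'n ^ 'd)"
proof -
  have "norm (column j M) \<le> norm (\<chi> i. norm (M $ i))"
    by (rule norm_le_componentwise_cart) (simp add: column_def component_le_norm_cart)
  then show ?thesis by (simp add: norm_vec_def)
qed

text \<open>A crude bound suffices to pass from closeness of all columns to closeness of matrices:
  every one of the \<open>CARD('d)\<close> rows is bounded by the sum of the column norms.\<close>

lemma norm_le_sum_columns: "norm (M :: real ^ 'n ^ 'd) \<le> CARD('d) * (\<Sum>j\<in>UNIV. norm (column j M))"
proof -
  have "norm M \<le> (\<Sum>i\<in>UNIV. norm (M $ i))" unfolding norm_vec_def by (rule L2_set_le_sum) auto
  also have "\<dots> \<le> (\<Sum>i\<in>(UNIV :: 'd set). \<Sum>j\<in>UNIV. norm (column j M))"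
  proof (rule sum_mono)
    fix i
    have "norm (M $ i) \<le> (\<Sum>j\<in>UNIV. \<bar>M $ i $ j\<bar>)" by (rule norm_le_l1_cart)
    also have "\<dots> \<le> (\<Sum>j\<in>UNIV. norm (column j M))"
    proof (rule sum_mono)
      show "\<bar>M $ i $ j\<bar> \<le> norm (column j M)" for j
        using component_le_norm_cart[of "column j M" i] by (simp add: column_def)
    qed
    finally show "norm (M $ i) \<le> (\<Sum>j\<in>UNIV. norm (column j M))" .
  qed
  finally show ?thesis by simp
qed

lemma column_diff: "column j (A - B) = column j A - column j B"
  by (simp add: column_def vec_eq_iff)

section \<open>Equivalence of the two density statements\<close>

theorem theorem1p6:
  fixes P :: "real ^ 'n ^ 'd"
  shows "closure (G P) = UNIV \<longleftrightarrow> closure {P ** A | A. good A} = UNIV"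
proof
  assume dense: "closure (G P) = UNIV"
  have "Q \<in> closure {P ** A | A. good A}" for Q :: "real ^ 'n ^ 'd"
    unfolding closure_approachable
  proof safe
    fix e :: real assume e: "e > 0"
    \<comment> \<open>One factor is the constant of \<open>norm_le_sum_columns\<close>, the other
      the number of columns summed.\<close>
    define K where "K = real CARD('d) * real CARD('n)"
    have K: "K > 0" by (simp add: K_def)
    have "adherent UNIV (\<lambda>j. column j P) (\<lambda>j. column j Q)"
      using dense by (intro dense_zspan_adherent[of UNIV UNIV]) (auto simp: G_eq_zspan)
    moreover have "e / K > 0" using e K by simp
    ultimately obtain v where v: "orb UNIV (\<lambda>j. column j P) v" "\<And>j. norm (v j - column j Q) < e / K"
      unfolding adherent_def by blast
    obtain A where A: "good A" "v = (\<lambda>j. column j (P ** A))"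
      using orb_columns_good[OF v(1)] by blast
    have "(\<Sum>j\<in>UNIV. norm (column j (P ** A - Q))) < (\<Sum>j\<in>(UNIV :: 'n set). e / K)"
      using v(2) A(2) by (intro sum_strict_mono) (auto simp: column_diff)
    then have "real CARD('d) * (\<Sum>j\<in>UNIV. norm (column j (P ** A - Q))) < real CARD('d) * (real CARD('n) * (e / K))"
      by (intro mult_strict_left_mono) auto
    also have "\<dots> = e" by (simp add: K_def)
    finally have "dist (P ** A) Q < e"
      using norm_le_sum_columns[of "P ** A - Q"] by (simp add: dist_norm)
    then show "\<exists>y\<in>{P ** A | A. good A}. dist y Q < e" using A(1) by blast
  qed
  then show "closure {P ** A | A. good A} = UNIV" by blast
next
  assume dense: "closure {P ** A | A. good A} = UNIV"
  have "y \<in> closure (G P)" for y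
    unfolding closure_approachable
  proof safe
    fix e :: real assume "e > 0"
    \<comment> \<open>All columns of \<open>Q\<close> equal \<open>y\<close>, so any one column of a
      nearby \<open>P ** A\<close> approximates \<open>y\<close>; it lies in \<open>G P\<close>
      because the columns of \<open>A\<close> are integral.\<close>
    define Q :: "real ^ 'n ^ 'd" where "Q = (\<chi> i j. y $ i)"
    have "Q \<in> closure {P ** A | A. good A}" using dense by simp
    then obtain A where A: "good A" "dist (P ** A) Q < e"
      using \<open>e > 0\<close> unfolding closure_approachable by blast
    obtain j :: 'n where True by simp
    have "column j (P ** A) = P *v column j A"
      by (simp add: vec_eq_iff column_def matrix_matrix_mult_def matrix_vector_mult_def)
    moreover have "\<forall>i. column j A $ i \<in> \<int>"
      using good_integer_entries[OF A(1)] by (simp add: column_def)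
    ultimately have "column j (P ** A) \<in> G P" unfolding G_def by blast
    moreover have "column j Q = y" by (simp add: Q_def column_def vec_eq_iff)
    then have "dist (column j (P ** A)) y < e"
      using norm_column_le[of j "P ** A - Q"] A(2) by (simp add: dist_norm column_diff)
    ultimately show "\<exists>z\<in>G P. dist z y < e" by blast
  qed
  then show "closure (G P) = UNIV" by blast
qed

end
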